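(* For the rhombus game on the triangular grid with $n$ winning sets, $\mathrm{SC}_2(\mathcal G_{\lozenge},2)\ge \frac{19n}{36}-o(n)$.
   Context: An $s$-of-$k$ game on a $k$-uniform hypergraph $(V,\mathcal F)$ (winning sets are $k$-element subsets of the finite set $V$), $1\le s\le k$: Maker and Breaker alternately claim unclaimed vertices, Maker first, until all are claimed; the score is the number of winning sets in which Maker claimed at least $s$ vertices (Maker maximizes, Breaker minimizes). A pairing strategy for Maker: she fixes in advance pairwise disjoint pairs of vertices and, whenever Breaker claims a vertex of a pair whose partner is unclaimed, she claims the partner (other moves arbitrary). $\mathrm{SC}_2(\mathcal H,s)$ is the largest score Maker can guarantee against every Breaker strategy using a pairing strategy. $\mathcal G_{\lozenge}$ is the hypergraph whose vertices are the points of a finite portion of the triangular lattice and whose winning sets are the vertex sets of all rhombi formed by two unit triangles sharing an edge, in all three orientations, so $k=4$. Grids are assumed "two-dimensional": the number of winning sets within constant distance of the boundary is $o(n)$, where $n$ is the number of winning sets; $o(n)$ refers to $n\to\infty$. *)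

theory Defs
  imports Complex_Main "HOL-Library.Landau_Symbols"
begin

subsection \<open>Maker-Breaker scoring games on a hypergraph with vertex set V and winning sets F\<close>

text \<open>A history is the list of the vertices claimed so far, oldest first. Maker moves first, so
  the entries at even positions are hers and it is her turn iff the length is even.\<close>

definition legal_strategy :: "'a set \<Rightarrow> ('a list \<Rightarrow> 'a) \<Rightarrow> bool" where
  "legal_strategy V \<sigma> \<longleftrightarrow> (\<forall>h. distinct h \<and> set h \<subset> V \<longrightarrow> \<sigma> h \<in> V - set h)"

primrec history :: "('a list \<Rightarrow> 'a) \<Rightarrow> ('a list \<Rightarrow> 'a) \<Rightarrow> nat \<Rightarrow> 'a list" where
  "history \<sigma> \<tau> 0 = []"
| "history \<sigma> \<tau> (Suc t) =
     history \<sigma> \<tau> t @ [if even t then \<sigma> (history \<sigma> \<tau> t) else \<tau> (history \<sigma> \<tau> t)]"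

definition maker_set :: "'a set \<Rightarrow> ('a list \<Rightarrow> 'a) \<Rightarrow> ('a list \<Rightarrow> 'a) \<Rightarrow> 'a set" where
  "maker_set V \<sigma> \<tau> = {history \<sigma> \<tau> (card V) ! i | i. i < card V \<and> even i}"

definition score :: "'a set set \<Rightarrow> nat \<Rightarrow> 'a set \<Rightarrow> nat" where
  "score F s M = card {W \<in> F. s \<le> card (W \<inter> M)}"

definition pairing :: "'a set \<Rightarrow> 'a set set \<Rightarrow> bool" where
  "pairing V P \<longleftrightarrow> (\<forall>p\<in>P. p \<subseteq> V \<and> card p = 2) \<and> pairwise disjnt P"

definition follows_pairing :: "'a set \<Rightarrow> 'a set set \<Rightarrow> ('a list \<Rightarrow> 'a) \<Rightarrow> bool" where
  "follows_pairing V P \<sigma> \<longleftrightarrow>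
     (\<forall>h v w. distinct (h @ [v]) \<and> set (h @ [v]) \<subseteq> V \<and> even (length (h @ [v])) \<and>
        {v, w} \<in> P \<and> w \<notin> set (h @ [v]) \<longrightarrow> \<sigma> (h @ [v]) = w)"

text \<open>Moves not dictated by the pairing are arbitrary, so a pairing guarantees a score only if
  every legal strategy following it reaches that score. (Letting Maker choose these moves would
  make the empty pairing as good as unrestricted play.)\<close>

definition pairing_guarantees :: "'a set \<Rightarrow> 'a set set \<Rightarrow> nat \<Rightarrow> 'a set set \<Rightarrow> nat \<Rightarrow> bool" where
  "pairing_guarantees V F s P t \<longleftrightarrow>
     (\<forall>\<sigma> \<tau>. legal_strategy V \<sigma> \<and> follows_pairing V P \<sigma> \<and> legal_strategy V \<tau> \<longrightarrow>
        t \<le> score F s (maker_set V \<sigma> \<tau>))"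

definition SC2 :: "'a set \<Rightarrow> 'a set set \<Rightarrow> nat \<Rightarrow> nat" where
  "SC2 V F s = Max {t. \<exists>P. pairing V P \<and> pairing_guarantees V F s P t}"

lemma ex_legal_strategy_following:
  assumes "pairing V P"
  shows "\<exists>\<sigma>. legal_strategy V \<sigma> \<and> follows_pairing V P \<sigma>"
proof -
  define Q where "Q h w \<longleftrightarrow> h \<noteq> [] \<and> {last h, w} \<in> P \<and> w \<notin> set h" for h w
  define \<sigma> where "\<sigma> h = (if \<exists>w. Q h w then SOME w. Q h w else SOME w. w \<in> V - set h)" for h
  have unique: "w = w'" if "Q h w" "Q h w'" for h w w'
  proof (rule ccontr)
    assume "w \<noteq> w'"
    then have ne: "{last h, w} \<noteq> {last h, w'}" by (auto simp: doubleton_eq_iff)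
    have P: "{last h, w} \<in> P" "{last h, w'} \<in> P" using that by (simp_all add: Q_def)
    have "pairwise disjnt P" using assms by (simp add: pairing_def)
    from pairwiseD[OF this P ne] have "disjnt {last h, w} {last h, w'}" .
    then show False by (simp add: disjnt_def)
  qed
  have forced: "Q h (\<sigma> h)" if ex: "\<exists>w. Q h w" for h
  proof -
    have "\<sigma> h = (SOME w. Q h w)" unfolding \<sigma>_def by (rule if_P[OF ex])
    with someI_ex[OF ex] show ?thesis by (simp only:)
  qed
  have free: "\<sigma> h \<in> V - set h" if nex: "\<not> (\<exists>w. Q h w)" and ex: "\<exists>w. w \<in> V - set h" for h
  proof -
    have "\<sigma> h = (SOME w. w \<in> V - set h)" unfolding \<sigma>_def by (rule if_not_P[OF nex])
    with someI_ex[OF ex] show ?thesis by (simp only:)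
  qed
  have "legal_strategy V \<sigma>"
    unfolding legal_strategy_def
  proof (intro allI impI)
    fix h assume h: "distinct h \<and> set h \<subset> V"
    show "\<sigma> h \<in> V - set h"
    proof (cases "\<exists>w. Q h w")
      case True
      then have "Q h (\<sigma> h)" by (rule forced)
      then have "{last h, \<sigma> h} \<in> P" "\<sigma> h \<notin> set h" by (simp_all add: Q_def)
      moreover have "\<forall>p\<in>P. p \<subseteq> V" using assms by (simp add: pairing_def)
      then have "{last h, \<sigma> h} \<subseteq> V" using \<open>{last h, \<sigma> h} \<in> P\<close> by (rule bspec)
      ultimately show ?thesis by simp
    next
      case False
      have "\<exists>w. w \<in> V - set h" using h by blast
      then show ?thesis by (rule free[OF False])
    qed
  qed
  moreover have "follows_pairing V P \<sigma>"
    unfolding follows_pairing_def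
  proof (intro allI impI)
    fix h v w
    assume "distinct (h @ [v]) \<and> set (h @ [v]) \<subseteq> V \<and> even (length (h @ [v])) \<and>
        {v, w} \<in> P \<and> w \<notin> set (h @ [v])"
    then have w: "Q (h @ [v]) w" by (simp add: Q_def)
    then have "Q (h @ [v]) (\<sigma> (h @ [v]))" by (intro forced exI)
    then show "\<sigma> (h @ [v]) = w" using w by (rule unique)
  qed
  ultimately show ?thesis by blast
qed

lemma guaranteed_scores_finite_nonempty:
  assumes "finite F"
  shows "finite {t. \<exists>P. pairing V P \<and> pairing_guarantees V F s P t}"
    and "{t. \<exists>P. pairing V P \<and> pairing_guarantees V F s P t} \<noteq> {}"
proof -
  have "t \<le> card F" if P: "pairing V P" and g: "pairing_guarantees V F s P t" for P t
  proof -
    obtain \<sigma> where "legal_strategy V \<sigma>" "follows_pairing V P \<sigma>"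
      using ex_legal_strategy_following[OF P] by blast
    then have "t \<le> score F s (maker_set V \<sigma> \<sigma>)"
      using g unfolding pairing_guarantees_def by blast
    also have "\<dots> \<le> card F"
      unfolding score_def using assms by (intro card_mono) auto
    finally show ?thesis .
  qed
  then have "{t. \<exists>P. pairing V P \<and> pairing_guarantees V F s P t} \<subseteq> {..card F}" by auto
  then show "finite {t. \<exists>P. pairing V P \<and> pairing_guarantees V F s P t}"
    by (rule finite_subset) simp
  have "pairing V {}" "pairing_guarantees V F s {} 0"
    by (auto simp: pairing_def pairing_guarantees_def)
  then show "{t. \<exists>P. pairing V P \<and> pairing_guarantees V F s P t} \<noteq> {}" by blast
qed

subsection \<open>The rhombus hypergraph on the triangular lattice\<close>

text \<open>The pair (a, b) stands for the lattice point a + b * cis (pi / 3) of the complex plane;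
  tri_dist2 is the squared Euclidean distance of two such points.\<close>

fun tri_dist2 :: "int \<times> int \<Rightarrow> int \<times> int \<Rightarrow> int" where
  "tri_dist2 (a, b) (c, d) = (a - c)\<^sup>2 + (a - c) * (b - d) + (b - d)\<^sup>2"

definition unit_triangle :: "(int \<times> int) set \<Rightarrow> bool" where
  "unit_triangle T \<longleftrightarrow> card T = 3 \<and> pairwise (\<lambda>p q. tri_dist2 p q = 1) T"

definition rhombi :: "(int \<times> int) set \<Rightarrow> (int \<times> int) set set" where
  "rhombi V = {T \<union> T' | T T'. unit_triangle T \<and> unit_triangle T' \<and> card (T \<inter> T') = 2 \<and>
                 T \<union> T' \<subseteq> V}"

subsection \<open>Two-dimensional families of grids\<close>

definition boundary :: "(int \<times> int) set \<Rightarrow> (int \<times> int) set" where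
  "boundary V = {q \<in> V. \<exists>r. r \<notin> V \<and> tri_dist2 q r = 1}"

definition near_boundary :: "nat \<Rightarrow> (int \<times> int) set \<Rightarrow> (int \<times> int) set set" where
  "near_boundary d V = {W \<in> rhombi V. \<exists>p\<in>W. \<exists>q\<in>boundary V. tri_dist2 p q \<le> (int d)\<^sup>2}"

text \<open>The o(n) bound is a function of the number n of winning sets alone, uniform over the family
  for each fixed distance d.\<close>

definition two_dimensional :: "(int \<times> int) set set \<Rightarrow> bool" where
  "two_dimensional \<V> \<longleftrightarrow>
     (\<forall>d. \<exists>b :: nat \<Rightarrow> real. b \<in> o(\<lambda>n. real n) \<and>
        (\<forall>V\<in>\<V>. real (card (near_boundary d V)) \<le> b (card (rhombi V))))"

end

theory Submission
  imports Defs
begin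

text \<open>Pair the lattice points (2i, b) and (2i + 1, b), so that Maker gets at least one point of each
  pair; the score is monotone, so count exactly one. Let s be the number of counted points in a rhombus. One sixth of the rhombi consist of two pairs
  and count for certain; one half contain exactly one pair, so s is 1, 2 or 3 and the rhombus
  contributes at least (s - 1) / 2; one third contain no pair and contribute at least (s - 1) / 3.
  The half turn about the midpoint of a pair preserves the pairing and swaps its two points, so both
  have the same total weight and the sum of the bounds depends on Maker's choices only near the
  boundary. On average s = 2, which gives 1/6 + 1/2 * 1/2 + 1/3 * 1/3 = 19/36.\<close>

subsection \<open>Playing against a pairing\<close>

lemma history_legal:
  assumes "finite V" "legal_strategy V \<sigma>" "legal_strategy V \<tau>" "t \<le> card V"
  shows "distinct (history \<sigma> \<tau> t) \<and> set (history \<sigma> \<tau> t) \<subseteq> V \<and> length (history \<sigma> \<tau> t) = t"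
  using assms(4)
proof (induction t)
  case (Suc t)
  let ?h = "history \<sigma> \<tau> t"
  have h: "distinct ?h" "set ?h \<subseteq> V" "length ?h = t" using Suc by auto
  moreover have "card (set ?h) = t" using h distinct_card by fastforce
  ultimately have "set ?h \<subset> V" using Suc.prems by auto
  with h assms(2,3) have "\<sigma> ?h \<in> V - set ?h" "\<tau> ?h \<in> V - set ?h"
    unfolding legal_strategy_def by blast+
  with h show ?case by auto
qed simp

text \<open>Unlike \<open>history_legal\<close>, this needs no legality, so prefixes of a history
  can be compared for arbitrary strategies.\<close>

lemma length_history: "length (history \<sigma> \<tau> t) = t"
  by (induction t) auto

lemma take_history: "t \<le> n \<Longrightarrow> take t (history \<sigma> \<tau> n) = history \<sigma> \<tau> t"
proof (induction n)
  case (Suc n)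
  then show ?case using length_history[of \<sigma> \<tau>] by (cases "t = Suc n") auto
qed simp

text \<open>Play exhausts \<open>V\<close>, so otherwise Breaker claims both points. At the earlier
  of the two claims the partner is still free, hence the pairing dictates it as Maker's very next
  move and she owns it after all.\<close>

lemma maker_set_hits_pair:
  assumes V: "finite V" and \<sigma>: "legal_strategy V \<sigma>" "follows_pairing V P \<sigma>"
    and \<tau>: "legal_strategy V \<tau>" and P: "pairing V P" "{v, w} \<in> P"
  shows "v \<in> maker_set V \<sigma> \<tau> \<or> w \<in> maker_set V \<sigma> \<tau>"
proof (rule ccontr)
  define N where "N = card V"
  define h where "h = history \<sigma> \<tau> N"
  assume nohit: "\<not> ?thesis"
  have legal: "distinct (history \<sigma> \<tau> t) \<and> set (history \<sigma> \<tau> t) \<subseteq> V \<and> length (history \<sigma> \<tau> t) = t"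
    if "t \<le> N" for t
    using history_legal[OF V \<sigma>(1) \<tau>] that by (simp add: N_def)
  have h: "distinct h" "set h \<subseteq> V" "length h = N" using legal[of N] by (auto simp: h_def)
  then have "card (set h) = card V" using distinct_card N_def by fastforce
  with h V have "set h = V" by (simp add: card_subset_eq)
  moreover have vw: "v \<in> V" "w \<in> V" "v \<noteq> w" using P by (auto simp: pairing_def)
  ultimately obtain i j where ij: "i < N" "h ! i = v" "j < N" "h ! j = w"
    using h by (metis in_set_conv_nth)
  have odd: "odd i" "odd j"
    using nohit ij by (auto simp: maker_set_def N_def h_def)
  \<comment> \<open>Stated for fresh \<open>v\<close>, \<open>w\<close> so that it serves both
    orders of the two claims. Position \<open>Suc i\<close> holds Maker's forced reply
    \<open>w\<close>, hence equals \<open>j\<close> by distinctness, although \<open>i\<close> and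
    \<open>j\<close> are both odd.\<close>
  have key: False
    if "i < N" "h ! i = v" "j < N" "h ! j = w" "odd i" "odd j" "i < j" "{v, w} \<in> P" for i j v w
  proof -
    have take: "take t h = history \<sigma> \<tau> t" if "t \<le> N" for t
      using take_history[OF that] by (simp add: h_def)
    have *: "history \<sigma> \<tau> (Suc i) = take i h @ [v]"
      using take[of "Suc i"] that h by (simp add: take_Suc_conv_app_nth del: history.simps)
    have "w \<notin> set (take (Suc i) h)"
      using that h by (auto simp: in_set_conv_nth nth_eq_iff_index_eq)
    then have "w \<notin> set (take i h @ [v])" using that h by (simp add: take_Suc_conv_app_nth)
    moreover have "distinct (take i h @ [v])" "set (take i h @ [v]) \<subseteq> V"
        "length (take i h @ [v]) = Suc i"
      using legal[of "Suc i"] that unfolding * by auto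
    ultimately have "\<sigma> (take i h @ [v]) = w"
      using \<sigma>(2) that unfolding follows_pairing_def by (metis even_Suc)
    moreover have "i + 2 \<le> N" using that by simp
    then have "history \<sigma> \<tau> (Suc (Suc i)) = take (Suc (Suc i)) h"
      by (intro take[symmetric]) simp
    then have "h ! Suc i = history \<sigma> \<tau> (Suc (Suc i)) ! Suc i" by simp
    moreover have "history \<sigma> \<tau> (Suc (Suc i)) ! Suc i = \<sigma> (take i h @ [v])"
      using * \<open>odd i\<close> legal[of "Suc i"] that
      by (simp add: nth_append del: history.simps(2) add: history.simps(2)[of _ _ "Suc i"])
    ultimately have eq: "h ! Suc i = h ! j" using that by simp
    then have "Suc i = j"
      using nth_eq_iff_index_eq[OF h(1), of "Suc i" j] h(3) that(3) eq \<open>i + 2 \<le> N\<close> by simp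
    then show False using \<open>odd i\<close> \<open>odd j\<close> by auto
  qed
  have "i \<noteq> j" using ij vw by auto
  then consider "i < j" | "j < i" by linarith
  then show False
    using key ij odd P(2) by cases (blast, metis insert_commute)
qed

text \<open>Scores are natural numbers, so the real bound may be rounded up; \<open>nat\<close>
  turns a negative bound into 0. The set under \<open>Max\<close> is finite, so each member is a
  lower bound for \<open>SC2\<close>.\<close>

lemma SC2_ge:
  assumes "finite F" "pairing V P"
    and "\<And>\<sigma> \<tau>. legal_strategy V \<sigma> \<Longrightarrow> follows_pairing V P \<sigma> \<Longrightarrow> legal_strategy V \<tau> \<Longrightarrow>
           x \<le> real (score F s (maker_set V \<sigma> \<tau>))"
  shows "x \<le> real (SC2 V F s)"
proof -
  have "pairing_guarantees V F s P (nat \<lceil>x\<rceil>)"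
    unfolding pairing_guarantees_def using assms(3) by (auto simp: nat_le_iff ceiling_le_iff)
  then have "nat \<lceil>x\<rceil> \<le> SC2 V F s"
    unfolding SC2_def using assms(2) guaranteed_scores_finite_nonempty(1)[OF assms(1)]
    by (intro Max_ge) auto
  then show ?thesis by linarith
qed

subsection \<open>The three orientations of rhombi\<close>

text \<open>The orientations differ in the direction of the edge shared by the two triangles: (1,
  -1) for \<open>rhombA\<close>, (0, 1) for \<open>rhombB\<close>, (1, 0) for \<open>rhombC\<close>.
  The base point (x, y) is not a vertex of \<open>rhombC x y\<close>, whose lowest row is still
  y.\<close>

definition rhombA :: "int \<Rightarrow> int \<Rightarrow> (int \<times> int) set" where
  "rhombA x y = {(x, y), (x + 1, y), (x, y + 1), (x + 1, y + 1)}"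

definition rhombB :: "int \<Rightarrow> int \<Rightarrow> (int \<times> int) set" where
  "rhombB x y = {(x, y), (x + 1, y), (x - 1, y + 1), (x, y + 1)}"

definition rhombC :: "int \<Rightarrow> int \<Rightarrow> (int \<times> int) set" where
  "rhombC x y = {(x + 1, y), (x, y + 1), (x + 1, y + 1), (x, y + 2)}"

lemmas rhomb_defs = rhombA_def rhombB_def rhombC_def

definition units :: "(int \<times> int) set" where
  "units = {(1, 0), (0, 1), (-1, 1), (-1, 0), (0, -1), (1, -1)}"

lemma tri_dist2_eq_1_iff: "tri_dist2 (a, b) (c, d) = 1 \<longleftrightarrow> (c - a, d - b) \<in> units"
proof
  assume "tri_dist2 (a, b) (c, d) = 1"
  then have e: "(a - c)\<^sup>2 + (a - c) * (b - d) + (b - d)\<^sup>2 = 1" by simp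
  define x y where "x = c - a" and "y = d - b"
  have e: "x * x + x * y + y * y = 1"
    using e by (simp add: x_def y_def power2_eq_square algebra_simps)
  \<comment> \<open>Completing the square in either variable confines both coordinates to -1, 0, 1,
    leaving nine candidates.\<close>
  have "4 * 1 = (2 * x + y)\<^sup>2 + 3 * y\<^sup>2" "4 * 1 = (2 * y + x)\<^sup>2 + 3 * x\<^sup>2"
    unfolding e[symmetric] by (simp_all add: power2_eq_square algebra_simps)
  moreover have "0 \<le> (2 * x + y)\<^sup>2" "0 \<le> (2 * y + x)\<^sup>2" by simp_all
  ultimately have "x\<^sup>2 < 4" "y\<^sup>2 < 4" by linarith+
  then have "\<bar>x\<bar> < 2" "\<bar>y\<bar> < 2" using power2_less_imp_less[of "\<bar>x\<bar>" 2] power2_less_imp_less[of "\<bar>y\<bar>" 2]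
    by simp_all
  then have "x = -1 \<or> x = 0 \<or> x = 1" "y = -1 \<or> y = 0 \<or> y = 1" by linarith+
  then have "(x, y) \<in> units" using e by (auto simp: units_def)
  then show "(c - a, d - b) \<in> units" by (simp add: x_def y_def)
next
  assume "(c - a, d - b) \<in> units"
  then consider "c = a + 1" "d = b" | "c = a" "d = b + 1" | "c = a - 1" "d = b + 1"
    | "c = a - 1" "d = b" | "c = a" "d = b - 1" | "c = a + 1" "d = b - 1"
    unfolding units_def by force
  then show "tri_dist2 (a, b) (c, d) = 1" by cases simp_all
qed

lemma unit_triangleI:
  "p \<noteq> q \<Longrightarrow> p \<noteq> r \<Longrightarrow> q \<noteq> r \<Longrightarrow> tri_dist2 p q = 1 \<Longrightarrow> tri_dist2 p r = 1 \<Longrightarrow> tri_dist2 q r = 1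
    \<Longrightarrow> tri_dist2 q p = 1 \<Longrightarrow> tri_dist2 r p = 1 \<Longrightarrow> tri_dist2 r q = 1 \<Longrightarrow> unit_triangle {p, q, r}"
  by (auto simp: unit_triangle_def pairwise_def)

lemma rhombusI:
  assumes "unit_triangle {p, q, r}" "unit_triangle {p, q, r'}" "p \<noteq> q" "r \<noteq> r'"
    "r \<notin> {p, q}" "{p, q, r, r'} \<subseteq> V"
  shows "{p, q, r, r'} \<in> rhombi V"
proof -
  have "{p, q, r} \<inter> {p, q, r'} = {p, q}" using assms by auto
  moreover have "{p, q, r, r'} = {p, q, r} \<union> {p, q, r'}" by auto
  moreover have "card {p, q} = 2" using assms(3) by simp
  ultimately have "{p, q, r, r'} = {p, q, r} \<union> {p, q, r'} \<and> unit_triangle {p, q, r} \<and>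
      unit_triangle {p, q, r'} \<and> card ({p, q, r} \<inter> {p, q, r'}) = 2 \<and> {p, q, r} \<union> {p, q, r'} \<subseteq> V"
    using assms(1,2,6) by simp
  then show ?thesis unfolding rhombi_def by blast
qed

lemma rhomb_in_rhombi:
  "rhombA x y \<subseteq> V \<Longrightarrow> rhombA x y \<in> rhombi V"
  "rhombB x y \<subseteq> V \<Longrightarrow> rhombB x y \<in> rhombi V"
  "rhombC x y \<subseteq> V \<Longrightarrow> rhombC x y \<in> rhombi V"
proof -
  have "rhombA x y = {(x + 1, y), (x, y + 1), (x, y), (x + 1, y + 1)}"
    "rhombB x y = {(x, y), (x, y + 1), (x + 1, y), (x - 1, y + 1)}"
    "rhombC x y = {(x, y + 1), (x + 1, y + 1), (x + 1, y), (x, y + 2)}"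
    by (auto simp: rhomb_defs)
  then show "rhombA x y \<subseteq> V \<Longrightarrow> rhombA x y \<in> rhombi V"
    "rhombB x y \<subseteq> V \<Longrightarrow> rhombB x y \<in> rhombi V"
    "rhombC x y \<subseteq> V \<Longrightarrow> rhombC x y \<in> rhombi V"
    by (simp_all, (intro rhombusI unit_triangleI; simp)+)
qed

text \<open>Move the end p of the shared edge pq to the origin. Then q, r, r' become unit vectors u,
  v, v', and v, v' must be the two neighbours of u in the hexagon of units: six choices of u and two
  orders.\<close>

lemma rhombi_cases:
  assumes "W \<in> rhombi V"
  obtains x y where "W = rhombA x y" | x y where "W = rhombB x y" | x y where "W = rhombC x y"
proof -
  from assms obtain T T' where T: "unit_triangle T" "unit_triangle T'" "card (T \<inter> T') = 2"
    and W: "W = T \<union> T'" by (auto simp: rhombi_def)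
  obtain p q where pq: "T \<inter> T' = {p, q}" "p \<noteq> q" using T(3) by (auto simp: card_2_iff)
  have third: "\<exists>r. U = {p, q, r} \<and> r \<noteq> p \<and> r \<noteq> q" if "unit_triangle U" "{p, q} \<subseteq> U" for U
  proof -
    have "card (U - {p, q}) = 1" using that pq by (subst card_Diff_subset) (auto simp: unit_triangle_def)
    then obtain r where "U - {p, q} = {r}" by (auto simp: card_1_singleton_iff)
    then show ?thesis using that by (intro exI[of _ r]) blast
  qed
  obtain r r' where r: "T = {p, q, r}" "r \<noteq> p" "r \<noteq> q" and r': "T' = {p, q, r'}" "r' \<noteq> p" "r' \<noteq> q"
    using third[OF T(1)] third[OF T(2)] pq by blast
  have "r \<noteq> r'" using pq r r' by auto
  obtain a b where p: "p = (a, b)" by (cases p)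
  have dist: "tri_dist2 p q = 1" "tri_dist2 p r = 1" "tri_dist2 p r' = 1" "tri_dist2 q r = 1"
      "tri_dist2 q r' = 1"
    using T r r' pq(2) by (auto simp: unit_triangle_def pairwise_def)
  define u where "u = (fst q - a, snd q - b)"
  define v where "v = (fst r - a, snd r - b)"
  define v' where "v' = (fst r' - a, snd r' - b)"
  have q: "q = (a + fst u, b + snd u)" and rv: "r = (a + fst v, b + snd v)"
    and rv': "r' = (a + fst v', b + snd v')" by (simp_all add: u_def v_def v'_def)
  have un: "u \<in> units" "v \<in> units" "v' \<in> units" "(fst v - fst u, snd v - snd u) \<in> units"
    "(fst v' - fst u, snd v' - snd u) \<in> units" "v \<noteq> v'"
    using dist \<open>r \<noteq> r'\<close> unfolding p q rv rv' tri_dist2_eq_1_iff by auto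
  have table: "\<forall>u\<in>units. \<forall>v\<in>units. \<forall>v'\<in>units. (fst v - fst u, snd v - snd u) \<in> units \<and>
      (fst v' - fst u, snd v' - snd u) \<in> units \<and> v \<noteq> v' \<longrightarrow> (u, v, v') \<in>
      {((1, 0), (0, 1), (1, -1)), ((1, 0), (1, -1), (0, 1)),
      ((0, 1), (-1, 1), (1, 0)), ((0, 1), (1, 0), (-1, 1)),
      ((-1, 1), (-1, 0), (0, 1)), ((-1, 1), (0, 1), (-1, 0)),
      ((-1, 0), (0, -1), (-1, 1)), ((-1, 0), (-1, 1), (0, -1)),
      ((0, -1), (1, -1), (-1, 0)), ((0, -1), (-1, 0), (1, -1)),
      ((1, -1), (1, 0), (0, -1)), ((1, -1), (0, -1), (1, 0))}"
    by (simp add: units_def)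
  have "(u, v, v') \<in>
      {((1, 0), (0, 1), (1, -1)), ((1, 0), (1, -1), (0, 1)),
      ((0, 1), (-1, 1), (1, 0)), ((0, 1), (1, 0), (-1, 1)),
      ((-1, 1), (-1, 0), (0, 1)), ((-1, 1), (0, 1), (-1, 0)),
      ((-1, 0), (0, -1), (-1, 1)), ((-1, 0), (-1, 1), (0, -1)),
      ((0, -1), (1, -1), (-1, 0)), ((0, -1), (-1, 0), (1, -1)),
      ((1, -1), (1, 0), (0, -1)), ((1, -1), (0, -1), (1, 0))}"
    by (rule table[rule_format, OF un(1-3) conjI[OF un(4) conjI[OF un(5,6)]]])
  moreover have "W = {(a, b), (a + fst u, b + snd u), (a + fst v, b + snd v), (a + fst v', b + snd v')}"
    unfolding W r r' p q rv rv' by auto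
  \<comment> \<open>Brings the top row of \<open>rhombC\<close> to the form \<open>b + 1\<close> in
    which the points of W appear.\<close>
  moreover have "b - 1 + 2 = b + 1" by simp
  then have "rhombC x (b - 1) = {(x + 1, b - 1), (x, b), (x + 1, b), (x, b + 1)}" for x
    unfolding rhombC_def by (simp only: diff_add_cancel)
  \<comment> \<open>Each orientation occurs twice, because p may be either end of the shared
    edge.\<close>
  ultimately have "W \<in> {rhombC a (b - 1), rhombB a b, rhombA (a - 1) b, rhombC (a - 1) (b - 1),
      rhombB a (b - 1), rhombA a (b - 1)}"
    by (elim insertE emptyE) (simp_all add: rhombA_def rhombB_def insert_commute)
  then show thesis using that by blast
qed

text \<open>One horizontal period of the pairing: both base points of the pair in row b, in all
  three orientations. In the listed order the rhombi contain 2, 0, 1, 1, 1, 0 whole pairs.\<close>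

definition cell_rhombi :: "int \<times> int \<Rightarrow> (int \<times> int) set set" where
  "cell_rhombi = (\<lambda>(i, b). {rhombA (2 * i) b, rhombA (2 * i + 1) b, rhombB (2 * i) b,
     rhombB (2 * i + 1) b, rhombC (2 * i) b, rhombC (2 * i + 1) b})"

lemma rhombi_subset_cells: "W \<in> rhombi V \<Longrightarrow> \<exists>c. W \<in> cell_rhombi c"
proof -
  assume "W \<in> rhombi V"
  moreover have "x = 2 * (x div 2) \<or> x = 2 * (x div 2) + 1" for x :: int by presburger
  ultimately show ?thesis
    by (elim rhombi_cases) (simp_all add: cell_rhombi_def split_paired_Ex, metis+)
qed

text \<open>Four times the centroid. It is an invariant that separates all rhombi: the residues mod
  4 give the orientation and the quotients the base point.\<close>

definition coord_sum :: "(int \<times> int) set \<Rightarrow> int \<times> int" where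
  "coord_sum W = (\<Sum>p\<in>W. fst p, \<Sum>p\<in>W. snd p)"

lemma coord_sum_rhomb:
  "coord_sum (rhombA x y) = (4 * x + 2, 4 * y + 2)"
  "coord_sum (rhombB x y) = (4 * x, 4 * y + 2)"
  "coord_sum (rhombC x y) = (4 * x + 2, 4 * y + 4)"
  by (simp_all add: coord_sum_def rhomb_defs)

text \<open>A rhombus determines its cell, so distinct cells are disjoint and sums over them add
  up.\<close>

lemma cell_of_rhombus:
  "W \<in> cell_rhombi c \<Longrightarrow> c = (fst (coord_sum W) div 8, (snd (coord_sum W) - 2) div 4)"
  by (auto simp: cell_rhombi_def coord_sum_rhomb split: prod.splits)

lemma rhomb_neq:
  "rhombA x y \<noteq> rhombB x' y'" "rhombA x y \<noteq> rhombC x' y'" "rhombB x y \<noteq> rhombC x' y'"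
  "x \<noteq> x' \<Longrightarrow> rhombA x y \<noteq> rhombA x' y'" "x \<noteq> x' \<Longrightarrow> rhombB x y \<noteq> rhombB x' y'"
  "x \<noteq> x' \<Longrightarrow> rhombC x y \<noteq> rhombC x' y'"
  by (rule notI, drule arg_cong[of _ _ coord_sum], simp add: coord_sum_rhomb; presburger)+

lemma finite_cell_rhombi: "finite (cell_rhombi c)"
  by (simp add: cell_rhombi_def split: prod.splits)

lemma card_cell_rhombi_le: "card (cell_rhombi c) \<le> 6"
proof -
  have "card (set [a1, a2, a3, a4, a5, a6]) \<le> 6" for a1 a2 a3 a4 a5 a6 :: "(int \<times> int) set"
    by (rule order.trans[OF card_length]) simp
  then show ?thesis by (simp add: cell_rhombi_def split: prod.splits)
qed

lemma sum_cell_rhombi: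
  fixes g :: "(int \<times> int) set \<Rightarrow> real"
  shows "sum g (cell_rhombi (i, b)) = g (rhombA (2 * i) b) + g (rhombA (2 * i + 1) b)
    + g (rhombB (2 * i) b) + g (rhombB (2 * i + 1) b) + g (rhombC (2 * i) b) + g (rhombC (2 * i + 1) b)"
  by (simp add: cell_rhombi_def rhomb_neq rhomb_neq[symmetric])

subsection \<open>The score of a cell\<close>

lemma card_Int_four:
  assumes "distinct [p, q, r, s]"
  shows "card ({p, q, r, s} \<inter> M)
    = of_bool (p \<in> M) + of_bool (q \<in> M) + of_bool (r \<in> M) + of_bool (s \<in> M)"
  using assms by (auto simp: Int_insert_left)

text \<open>A left point is counted z times, and a right point is Maker's at least when its left
  partner is not, so it is counted 1 - z times. Every rhombus has two points of each kind; hence all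
  z-terms group into differences of translates, which nearly cancel when summed over cells. The
  constant is 1 + 3 * 1/2 + 2 * 1/3 = 19/6.\<close>

lemma cell_score:
  fixes M :: "(int \<times> int) set" and i b :: int
  defines "z \<equiv> \<lambda>i b. of_bool ((2 * i, b) \<in> M) :: real"
  assumes hit: "\<And>i' b'. i' \<in> {i - 1..i + 1} \<Longrightarrow> b' \<in> {b..b + 2} \<Longrightarrow>
      (2 * i', b') \<in> M \<or> (2 * i' + 1, b') \<in> M"
  shows "(\<Sum>W\<in>cell_rhombi (i, b). of_bool (2 \<le> card (W \<inter> M)))
    \<ge> 19 / 6
      + ((z (i + 1) b - z i b) + (z (i + 1) (b + 1) - z i (b + 1))
        + (z (i + 1) b - z i (b + 1)) + (z (i + 1) (b + 1) - z i (b + 2))) / 3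
      + ((z i (b + 1) - z (i - 1) (b + 1)) + (z (i + 1) b - z i b) + (z i (b + 2) - z i b)) / 2"
proof -
  let ?s = "\<lambda>W. of_bool (2 \<le> card (W \<inter> M)) :: real"
  have "?s (rhombA (2 * i) b) \<ge> 1"
    using hit[of i b] hit[of i "b + 1"]
    by (auto simp: rhombA_def card_Int_four)
  \<comment> \<open>No whole pair: the numerator is the number of counted points minus 1, which is
    at most 3 and positive only from two counted points on.\<close>
  moreover have "?s (rhombA (2 * i + 1) b)
      \<ge> (1 - z i b + z (i + 1) b - z i (b + 1) + z (i + 1) (b + 1)) / 3"
    using hit[of i b] hit[of i "b + 1"]
    by (auto simp: rhombA_def card_Int_four z_def algebra_simps of_bool_def)
  \<comment> \<open>The whole pair supplies one counted point, so the numerator is the count of the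
    other two points.\<close>
  moreover have "?s (rhombB (2 * i) b) \<ge> (1 - z (i - 1) (b + 1) + z i (b + 1)) / 2"
    using hit[of i b] hit[of "i - 1" "b + 1"]
    by (auto simp: rhombB_def card_Int_four z_def algebra_simps of_bool_def)
  moreover have "?s (rhombB (2 * i + 1) b) \<ge> (1 - z i b + z (i + 1) b) / 2"
    using hit[of i b] hit[of i "b + 1"]
    by (auto simp: rhombB_def card_Int_four z_def algebra_simps of_bool_def)
  moreover have "?s (rhombC (2 * i) b) \<ge> (1 - z i b + z i (b + 2)) / 2"
    using hit[of i b] hit[of i "b + 1"]
    by (auto simp: rhombC_def card_Int_four z_def algebra_simps of_bool_def)
  moreover have "?s (rhombC (2 * i + 1) b)
      \<ge> (1 + z (i + 1) b - z i (b + 1) + z (i + 1) (b + 1) - z i (b + 2)) / 3"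
    using hit[of i "b + 2"] hit[of i "b + 1"]
    by (auto simp: rhombC_def card_Int_four z_def algebra_simps of_bool_def)
  ultimately show ?thesis unfolding sum_cell_rhombi by argo
qed

text \<open>Shifted terms that stay in G are distinct terms of the sum of g over G; each of the
  others costs at most 1.\<close>

lemma sum_shift_diff_ge:
  fixes g :: "'a \<Rightarrow> real"
  assumes "finite G" "inj_on s G" "\<And>c. 0 \<le> g c" "\<And>c. g c \<le> 1"
  shows "(\<Sum>c\<in>G. g c - g (s c)) \<ge> - real (card {c \<in> G. s c \<notin> G})"
proof -
  let ?I = "{c \<in> G. s c \<in> G}" and ?O = "{c \<in> G. s c \<notin> G}"
  have "(\<Sum>c\<in>G. g (s c)) = (\<Sum>c\<in>?I \<union> ?O. g (s c))" by (rule sum.cong) auto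
  also have "\<dots> = (\<Sum>c\<in>?I. g (s c)) + (\<Sum>c\<in>?O. g (s c))"
    by (rule sum.union_disjoint) (use assms(1) in auto)
  also have "(\<Sum>c\<in>?I. g (s c)) = sum g (s ` ?I)"
    by (rule sum.reindex_cong[symmetric, of s]) (use assms(2) in \<open>auto simp: inj_on_def\<close>)
  also have "\<dots> \<le> sum g G" by (rule sum_mono2) (use assms in auto)
  also have "(\<Sum>c\<in>?O. g (s c)) \<le> real (card ?O)" using sum_bounded_above[of ?O "\<lambda>c. g (s c)" 1] assms(4)
    by simp
  finally show ?thesis by (simp add: sum_subtractf)
qed

subsection \<open>Cells near the boundary\<close>

text \<open>Walk from the inner to the outer point by coordinate steps, which are lattice edges. The
  last point before the walk first leaves V lies on the boundary.\<close>

lemma boundary_between: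
  assumes "(a, b) \<in> V" "(c, d) \<notin> V" "\<bar>c - a\<bar> + \<bar>d - b\<bar> \<le> int k"
  shows "\<exists>x y. (x, y) \<in> boundary V \<and> \<bar>x - a\<bar> + \<bar>y - b\<bar> \<le> int k"
  using assms
proof (induction k arbitrary: a b)
  case 0
  then have "c = a" "d = b" by auto
  with 0 show ?case by simp
next
  case (Suc k)
  define u where "u = (if c \<noteq> a then (sgn (c - a), 0) else (0, sgn (d - b)))"
  define a' b' where "a' = a + fst u" and "b' = b + snd u"
  have "(a, b) \<noteq> (c, d)" using Suc.prems by auto
  then have u: "(a' - a, b' - b) \<in> units" "\<bar>c - a'\<bar> + \<bar>d - b'\<bar> \<le> int k"
      "\<bar>a' - a\<bar> + \<bar>b' - b\<bar> \<le> 1"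
    using Suc.prems(3) by (auto simp: a'_def b'_def u_def units_def sgn_if)
  show ?case
  proof (cases "(a', b') \<in> V")
    case True
    then obtain x y where "(x, y) \<in> boundary V" "\<bar>x - a'\<bar> + \<bar>y - b'\<bar> \<le> int k"
      using Suc.IH u(2) Suc.prems(2) by blast
    then show ?thesis using u(3) by (intro exI[of _ x] exI[of _ y]) auto
  next
    case False
    then have "(a, b) \<in> boundary V"
      using Suc.prems(1) u(1) tri_dist2_eq_1_iff unfolding boundary_def by blast
    then show ?thesis by (intro exI[of _ a] exI[of _ b]) auto
  qed
qed

text \<open>Lets distances be estimated coordinatewise, where linear arithmetic suffices.\<close>

lemma tri_dist2_le_L1: "\<bar>x - a\<bar> + \<bar>y - b\<bar> \<le> k \<Longrightarrow> tri_dist2 (a, b) (x, y) \<le> k\<^sup>2"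
proof -
  assume k: "\<bar>x - a\<bar> + \<bar>y - b\<bar> \<le> k"
  have "(x - a) * (y - b) \<le> \<bar>x - a\<bar> * \<bar>y - b\<bar>" by (metis abs_ge_self abs_mult)
  moreover have "0 \<le> \<bar>x - a\<bar> * \<bar>y - b\<bar>" by simp
  moreover have "(\<bar>x - a\<bar> + \<bar>y - b\<bar>)\<^sup>2 = (x - a)\<^sup>2 + 2 * (\<bar>x - a\<bar> * \<bar>y - b\<bar>) + (y - b)\<^sup>2"
    by (simp add: power2_sum)
  moreover have "tri_dist2 (a, b) (x, y) = (x - a)\<^sup>2 + (x - a) * (y - b) + (y - b)\<^sup>2"
    by (simp add: power2_eq_square algebra_simps)
  ultimately have "tri_dist2 (a, b) (x, y) \<le> (\<bar>x - a\<bar> + \<bar>y - b\<bar>)\<^sup>2" by linarith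
  also have "\<dots> \<le> k\<^sup>2" using k by (intro power_mono) auto
  finally show ?thesis .
qed

lemma near_boundaryI:
  assumes "W \<in> rhombi V" "W \<subseteq> V" "(a, b) \<in> W" "(c, d) \<notin> V" "\<bar>c - a\<bar> + \<bar>d - b\<bar> \<le> int k"
  shows "W \<in> near_boundary k V"
proof -
  obtain x y where "(x, y) \<in> boundary V" "\<bar>x - a\<bar> + \<bar>y - b\<bar> \<le> int k"
    using boundary_between[of a b V c d k] assms by blast
  with tri_dist2_le_L1[OF this(2)] assms(1,3) show ?thesis
    unfolding near_boundary_def by blast
qed

text \<open>Radius 4 leaves room for all rhombi of the cell and for all pairs used in
  \<open>cell_score\<close>.\<close>

definition block :: "int \<times> int \<Rightarrow> (int \<times> int) set" where
  "block = (\<lambda>(i, b). {2 * i - 4..2 * i + 4} \<times> {b - 4..b + 4})"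

definition inner_cells :: "(int \<times> int) set \<Rightarrow> (int \<times> int) set" where
  "inner_cells V = {c. block c \<subseteq> V}"

lemma finite_rhombi: "finite V \<Longrightarrow> finite (rhombi V)"
  by (rule finite_subset[of _ "Pow V"]) (auto simp: rhombi_def)

lemma rhombi_subset: "W \<in> rhombi V \<Longrightarrow> W \<subseteq> V"
  by (auto simp: rhombi_def)

lemma finite_inner_cells: "finite V \<Longrightarrow> finite (inner_cells V)"
proof (rule finite_imageD)
  show "finite V \<Longrightarrow> finite ((\<lambda>(i, b). (2 * i, b)) ` inner_cells V)"
    by (erule finite_subset[rotated]) (auto simp: inner_cells_def block_def)
qed (auto simp: inj_on_def)

lemma inner_cell_rhombi:
  assumes "c \<in> inner_cells V"
  shows "cell_rhombi c \<subseteq> rhombi V"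
proof -
  obtain i b where c: "c = (i, b)" by (cases c)
  have *: "block (i, b) \<subseteq> V" using assms by (simp add: inner_cells_def c)
  have "W \<subseteq> block (i, b)" if "W \<in> cell_rhombi (i, b)" for W
    using that by (auto simp: cell_rhombi_def block_def rhomb_defs)
  with * have "\<Union>(cell_rhombi (i, b)) \<subseteq> V" by blast
  then show ?thesis
    by (auto simp: c cell_rhombi_def intro!: rhomb_in_rhombi)
qed

lemma rhombi_subset_inner_or_near:
  "rhombi V \<subseteq> \<Union> (cell_rhombi ` inner_cells V) \<union> near_boundary 20 V"
proof
  fix W assume W: "W \<in> rhombi V"
  then obtain i b where c: "W \<in> cell_rhombi (i, b)" using rhombi_subset_cells by fastforce
  show "W \<in> \<Union> (cell_rhombi ` inner_cells V) \<union> near_boundary 20 V"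
  proof (cases "(i, b) \<in> inner_cells V")
    case False
    then obtain x y where xy: "(x, y) \<notin> V" "(x, y) \<in> block (i, b)" by (auto simp: inner_cells_def)
    \<comment> \<open>Every rhombus of the cell has a vertex in row b at distance at most 2 from
      (2i, b); the missing block point is at most 4 + 4 away from (2i, b), so 10 in total, within
      the allowed 20.\<close>
    have "(2 * i, b) \<in> W \<or> (2 * i + 1, b) \<in> W \<or> (2 * i + 2, b) \<in> W"
      using c unfolding cell_rhombi_def by (auto simp: rhomb_defs)
    moreover have "\<bar>2 * i - 2 * i\<bar> \<le> 2" "\<bar>2 * i + 1 - 2 * i\<bar> \<le> 2" "\<bar>2 * i + 2 - 2 * i\<bar> \<le> 2" by simp_all
    ultimately obtain x' where "(x', b) \<in> W" "\<bar>x' - 2 * i\<bar> \<le> 2" by blast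
    moreover have "\<bar>x - 2 * i\<bar> \<le> 4" "\<bar>y - b\<bar> \<le> 4" using xy(2) by (auto simp: block_def)
    ultimately have "W \<in> near_boundary 20 V"
      using W xy(1) by (intro near_boundaryI[of W V x' b x y] rhombi_subset) auto
    then show ?thesis by simp
  qed (use c in blast)
qed

lemma card_rhombi_le:
  assumes "finite V"
  shows "card (rhombi V) \<le> 6 * card (inner_cells V) + card (near_boundary 20 V)"
proof -
  have fin: "finite (near_boundary 20 V)"
    by (rule finite_subset[OF _ finite_rhombi[OF assms]]) (auto simp: near_boundary_def)
  have "card (rhombi V) \<le> card (\<Union> (cell_rhombi ` inner_cells V) \<union> near_boundary 20 V)"
    by (rule card_mono[OF _ rhombi_subset_inner_or_near])
      (use fin finite_inner_cells[OF assms] finite_cell_rhombi in auto)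
  also have "\<dots> \<le> card (\<Union> (cell_rhombi ` inner_cells V)) + card (near_boundary 20 V)"
    by (rule card_Un_le)
  also have "card (\<Union> (cell_rhombi ` inner_cells V)) \<le> (\<Sum>c\<in>inner_cells V. card (cell_rhombi c))"
    by (rule card_UN_le[OF finite_inner_cells[OF assms]])
  also have "\<dots> \<le> 6 * card (inner_cells V)"
    using sum_bounded_above[of "inner_cells V" "\<lambda>c. card (cell_rhombi c)" 6] card_cell_rhombi_le by simp
  finally show ?thesis by simp
qed

text \<open>Charge each such cell to its \<open>rhombA\<close> with even base point. The shift moves
  the block by at most 2 in each coordinate, so a missing point lies within 6 + 6 of that
  rhombus.\<close>

lemma card_shifted_out_le:
  assumes "finite V" "\<bar>k\<bar> \<le> 1" "\<bar>l\<bar> \<le> 2"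
  shows "card {c \<in> inner_cells V. (fst c + k, snd c + l) \<notin> inner_cells V} \<le> card (near_boundary 20 V)"
    (is "card ?O \<le> _")
proof (rule card_inj_on_le)
  show "inj_on (\<lambda>c. rhombA (2 * fst c) (snd c)) ?O"
  proof (rule inj_onI)
    fix c c' :: "int \<times> int"
    assume "rhombA (2 * fst c) (snd c) = rhombA (2 * fst c') (snd c')"
    then have "coord_sum (rhombA (2 * fst c) (snd c)) = coord_sum (rhombA (2 * fst c') (snd c'))" by simp
    then show "c = c'" by (simp add: coord_sum_rhomb prod_eq_iff)
  qed
  show "(\<lambda>c. rhombA (2 * fst c) (snd c)) ` ?O \<subseteq> near_boundary 20 V"
  proof clarify
    fix i b
    assume c: "(i, b) \<in> inner_cells V" and "(fst (i, b) + k, snd (i, b) + l) \<notin> inner_cells V"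
    then obtain x y where xy: "(x, y) \<notin> V" "(x, y) \<in> block (i + k, b + l)"
      by (auto simp: inner_cells_def)
    have "rhombA (2 * i) b \<in> rhombi V"
      using inner_cell_rhombi[OF c] by (auto simp: cell_rhombi_def)
    moreover have "(2 * i, b) \<in> rhombA (2 * i) b" by (simp add: rhombA_def)
    moreover have "\<bar>x - 2 * i\<bar> + \<bar>y - b\<bar> \<le> int 20" using xy(2) assms(2,3) by (auto simp: block_def)
    ultimately show "rhombA (2 * fst (i, b)) (snd (i, b)) \<in> near_boundary 20 V"
      using xy(1) by (auto intro!: near_boundaryI[of _ V "2 * i" b x y] dest: rhombi_subset)
  qed
  show "finite (near_boundary 20 V)"
    by (rule finite_subset[OF _ finite_rhombi[OF assms(1)]]) (auto simp: near_boundary_def)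
qed

subsection \<open>The horizontal pairing\<close>

definition row_pairs :: "(int \<times> int) set \<Rightarrow> (int \<times> int) set set" where
  "row_pairs V = {{(2 * i, b), (2 * i + 1, b)} | i b. {(2 * i, b), (2 * i + 1, b)} \<subseteq> V}"

lemma pairing_row_pairs: "pairing V (row_pairs V)"
  unfolding pairing_def
proof
  show "\<forall>p\<in>row_pairs V. p \<subseteq> V \<and> card p = 2" by (auto simp: row_pairs_def)
  show "pairwise disjnt (row_pairs V)"
    unfolding pairwise_def row_pairs_def disjnt_def by (auto; presburger)
qed

lemma score_ge:
  assumes V: "finite V" and hit: "\<And>i b. {(2 * i, b), (2 * i + 1, b)} \<subseteq> V \<Longrightarrow>
      (2 * i, b) \<in> M \<or> (2 * i + 1, b) \<in> M"
  shows "real (score (rhombi V) 2 M)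
    \<ge> 19 / 36 * real (card (rhombi V)) - 4 * real (card (near_boundary 20 V))"
proof -
  define G where "G = inner_cells V"
  define m where "m = real (card (near_boundary 20 V))"
  define z where "z i b = (of_bool ((2 * i, b) \<in> M) :: real)" for i b
  define g where "g W = (of_bool (2 \<le> card (W \<inter> M)) :: real)" for W
  \<comment> \<open>One bracketed difference of \<open>cell_score\<close>, summed over all inner
    cells.\<close>
  define D where "D p q p' q' = (\<Sum>c\<in>G. z (fst c + p) (snd c + q) - z (fst c + p') (snd c + q'))"
    for p q p' q'
  have G: "finite G" unfolding G_def by (rule finite_inner_cells[OF V])
  have D: "- m \<le> D p q p' q'" if "\<bar>p' - p\<bar> \<le> 1" "\<bar>q' - q\<bar> \<le> 2" for p q p' q'
  proof -
    define k l where "k = p' - p" and "l = q' - q"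
    have "inj_on (\<lambda>c. (fst c + k, snd c + l)) G" by (auto simp: inj_on_def prod_eq_iff)
    from sum_shift_diff_ge[OF G this, of "\<lambda>c. z (fst c + p) (snd c + q)"]
    have "- real (card {c \<in> G. (fst c + k, snd c + l) \<notin> G}) \<le> D p q p' q'"
      by (simp add: D_def z_def k_def l_def)
    moreover have "real (card {c \<in> G. (fst c + k, snd c + l) \<notin> G}) \<le> m"
      using card_shifted_out_le[OF V that] by (simp add: G_def m_def k_def l_def)
    ultimately show ?thesis by linarith
  qed
  have D': "- m \<le> D 1 0 0 0" "- m \<le> D 1 1 0 1" "- m \<le> D 1 0 0 1" "- m \<le> D 1 1 0 2"
    "- m \<le> D 0 1 (-1) 1" "- m \<le> D 0 2 0 0"
    by (rule D; simp)+
  have "19 / 6 * real (card G)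
      + (D 1 0 0 0 + D 1 1 0 1 + D 1 0 0 1 + D 1 1 0 2) / 3
      + (D 0 1 (-1) 1 + D 1 0 0 0 + D 0 2 0 0) / 2
    = (\<Sum>(i, b)\<in>G. 19 / 6
      + ((z (i + 1) b - z i b) + (z (i + 1) (b + 1) - z i (b + 1))
        + (z (i + 1) b - z i (b + 1)) + (z (i + 1) (b + 1) - z i (b + 2))) / 3
      + ((z i (b + 1) - z (i - 1) (b + 1)) + (z (i + 1) b - z i b) + (z i (b + 2) - z i b)) / 2)"
    unfolding D_def case_prod_unfold
    by (simp add: sum.distrib sum_subtractf sum_divide_distrib[symmetric] sum_distrib_left[symmetric]
        sum_negf)
  also have "\<dots> \<le> (\<Sum>c\<in>G. \<Sum>W\<in>cell_rhombi c. g W)"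
  proof (rule sum_mono, clarify)
    fix i b assume "(i, b) \<in> G"
    then have "block (i, b) \<subseteq> V" by (simp add: G_def inner_cells_def)
    then have "(2 * i', b') \<in> M \<or> (2 * i' + 1, b') \<in> M"
      if "i' \<in> {i - 1..i + 1}" "b' \<in> {b..b + 2}" for i' b'
      using that by (intro hit) (auto simp: block_def subset_iff)
    then show "19 / 6
      + ((z (i + 1) b - z i b) + (z (i + 1) (b + 1) - z i (b + 1))
        + (z (i + 1) b - z i (b + 1)) + (z (i + 1) (b + 1) - z i (b + 2))) / 3
      + ((z i (b + 1) - z (i - 1) (b + 1)) + (z (i + 1) b - z i b) + (z i (b + 2) - z i b)) / 2
      \<le> sum g (cell_rhombi (i, b))"
      unfolding z_def g_def by (rule cell_score)
  qed
  also have "\<dots> = sum g (\<Union>c\<in>G. cell_rhombi c)"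
  proof (rule sum.UNION_disjoint[symmetric])
    show "\<forall>c\<in>G. \<forall>c'\<in>G. c \<noteq> c' \<longrightarrow> cell_rhombi c \<inter> cell_rhombi c' = {}"
      using cell_of_rhombus by blast
  qed (use G finite_cell_rhombi in auto)
  also have "\<dots> \<le> sum g (rhombi V)"
    by (rule sum_mono2[OF finite_rhombi[OF V]])
      (use inner_cell_rhombi in \<open>auto simp: G_def g_def\<close>)
  also have "\<dots> = real (score (rhombi V) 2 M)"
    using finite_rhombi[OF V] by (simp add: g_def score_def of_bool_def sum.If_cases Int_def)
  \<comment> \<open>Four differences with weight 1/3 and three with weight 1/2, each at least -m,
    give the loss 4/3 + 3/2 = 17/6.\<close>
  finally have "19 / 6 * real (card G) - 17 / 6 * m \<le> real (score (rhombi V) 2 M)"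
    using D' by argo
  moreover have "real (card (rhombi V)) \<le> 6 * real (card G) + m"
    using card_rhombi_le[OF V] unfolding G_def m_def by linarith
  moreover have "0 \<le> m" by (simp add: m_def)
  \<comment> \<open>Replacing \<open>card G\<close> by (n - m) / 6, with n the number of rhombi,
    raises the loss to 17/6 + 19/36 = 121/36 times m, rounded up to 4.\<close>
  ultimately show ?thesis unfolding m_def[symmetric] by argo
qed

theorem theorem15:
  fixes \<V> :: "(int \<times> int) set set"
  assumes "\<And>V. V \<in> \<V> \<Longrightarrow> finite V"
    and "two_dimensional \<V>"
  shows "\<exists>f :: nat \<Rightarrow> real. f \<in> o(\<lambda>n. real n) \<and>
           (\<forall>V\<in>\<V>. real (SC2 V (rhombi V) 2)
              \<ge> 19 * real (card (rhombi V)) / 36 - f (card (rhombi V)))"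
proof -
  obtain e :: "nat \<Rightarrow> real" where e: "e \<in> o(\<lambda>n. real n)"
    and near: "\<And>V. V \<in> \<V> \<Longrightarrow> real (card (near_boundary 20 V)) \<le> e (card (rhombi V))"
    using assms(2) unfolding two_dimensional_def by meson
  \<comment> \<open>The error is four times the bound for distance 20, so it depends on n alone and
    is uniform over the family.\<close>
  have "(\<lambda>n. 4 * e n) \<in> o(\<lambda>n. real n)" using e by simp
  moreover have "19 * real (card (rhombi V)) / 36 - 4 * e (card (rhombi V)) \<le> real (SC2 V (rhombi V) 2)"
    if V: "V \<in> \<V>" for V
  proof (rule SC2_ge[OF finite_rhombi pairing_row_pairs])
    show fin: "finite V" using assms(1) V .
    fix \<sigma> \<tau>
    assume s: "legal_strategy V \<sigma>" "follows_pairing V (row_pairs V) \<sigma>" "legal_strategy V \<tau>"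
    have "(2 * i, b) \<in> maker_set V \<sigma> \<tau> \<or> (2 * i + 1, b) \<in> maker_set V \<sigma> \<tau>"
      if "{(2 * i, b), (2 * i + 1, b)} \<subseteq> V" for i b
      using that by (intro maker_set_hits_pair[OF fin s pairing_row_pairs]) (auto simp: row_pairs_def)
    from score_ge[OF fin this] near[OF V]
    show "19 * real (card (rhombi V)) / 36 - 4 * e (card (rhombi V))
        \<le> real (score (rhombi V) 2 (maker_set V \<sigma> \<tau>))"
      by simp
  qed
  ultimately show ?thesis by blast
qed

end
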